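(* Let $\{\Phi_m\}_{m\ge 0}$ be a sequence of polynomials satisfying \[ \Phi_0(x)=1,\qquad \Phi_1(x)=a_1x+b_1,\qquad \Phi_m(x)=(a_mx+b_m)\Phi_{m-1}(x)-c_m\Phi_{m-2}(x)\quad (m\ge 2), \] where $a_m,b_m,c_m$ are constants with $a_mc_m\neq 0$. For a constant $c$ and $m\ge 1$ let $\Phi_{m;c}(x)=\Phi_m(x)+c\,\Phi_{m-1}(x)$. Let $n\ge 2$ be an integer and let $s,t$ be constants. Then \[ \operatorname{Res}(\Phi_{n;s},\Phi_{n-1;t})=(-1)^{n(n+1)/2}\,a_n^n c_n^{-n}\prod_{k=1}^n a_k^{2n-2k-1}c_k^{k-1}\cdot t^n\,\Phi_{n;s}\!\left(-\frac{c_n+b_nt+st}{a_nt}\right). \] In particular, if $t=0$, then \[ \operatorname{Res}(\Phi_{n;s},\Phi_{n-1})=\operatorname{Res}(\Phi_n,\Phi_{n-1})=(-1)^{n(n-1)/2}\prod_{k=1}^n a_k^{2n-2k}c_k^{k-1}. \]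
   Context: Constants are real or complex numbers. For polynomials $f(x)=a_0\prod_{i=1}^n(x-\alpha_i)$ of degree $n$ and $g(x)=b_0\prod_{j=1}^m(x-\beta_j)$ of degree $m$, the resultant (Sylvester determinant) is $\operatorname{Res}(f,g)=a_0^mb_0^n\prod_{i=1}^n\prod_{j=1}^m(\alpha_i-\beta_j)=a_0^m\prod_{i=1}^n g(\alpha_i)$. The factor $c_k^{k-1}$ for $k=1$ equals $1$ (only $c_m$ with $m\ge2$ matter). The expression $t^n\Phi_{n;s}(-(c_n+b_nt+st)/(a_nt))$ is a polynomial in $t$ (since $\deg\Phi_{n;s}=n$); at $t=0$ it denotes the value of that polynomial. *)

theory Defs
  imports Complex_Main "Subresultants.Resultant_Prelim"
begin

(* For the recurrence-defined sequence: Phi_{m;c} = Phi_m + c Phi_{m-1}, meant for m >= 1. *)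
definition shifted :: "(nat \<Rightarrow> 'a::comm_ring_1 poly) \<Rightarrow> nat \<Rightarrow> 'a \<Rightarrow> 'a poly" where
  "shifted Phi m c = Phi m + smult c (Phi (m - 1))"

(* An expression f(u) that is meaningful only for nonzero u, but agrees there with a polynomial
   in u, denotes at every t (t = 0 included) the value of that polynomial.  Such a polynomial is
   unique (poly_extension_eq); for the expression u^n * q(-(k + l u + s u) / (m u)) with
   degree q <= n and m nonzero it exists (poly_extension_exists).  Reading f 0 directly would be
   wrong, because division by zero yields zero. *)
definition poly_extension :: "('a::real_normed_field \<Rightarrow> 'a) \<Rightarrow> 'a \<Rightarrow> 'a" where
  "poly_extension f t = poly (THE P. \<forall>u. u \<noteq> 0 \<longrightarrow> poly P u = f u) t"

lemma poly_extension_eq: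
  fixes P :: "'a::real_normed_field poly"
  assumes P: "\<And>u. u \<noteq> 0 \<Longrightarrow> poly P u = f u"
  shows "poly_extension f t = poly P t"
proof -
  have "Q = P" if Q: "\<forall>u. u \<noteq> 0 \<longrightarrow> poly Q u = f u" for Q
  proof (rule ccontr)
    assume "Q \<noteq> P"
    then have "finite {u. poly (Q - P) u = 0}"
      by (intro poly_roots_finite) simp
    moreover have "UNIV - {0} \<subseteq> {u. poly (Q - P) u = 0}"
      using P Q by auto
    ultimately have "finite (UNIV - {0::'a})"
      by (rule rev_finite_subset)
    then show False
      by (simp add: infinite_UNIV_char_0)
  qed
  then have "(THE P. \<forall>u. u \<noteq> 0 \<longrightarrow> poly P u = f u) = P"
    using P by (intro the_equality) auto
  then show ?thesis
    by (simp add: poly_extension_def)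
qed

lemma poly_extension_exists:
  fixes q :: "'a::real_normed_field poly"
  assumes deg: "degree q \<le> n" and m: "m \<noteq> 0"
  obtains P where "\<And>u. u \<noteq> 0 \<Longrightarrow> poly P u = u ^ n * poly q (- (k + l * u + s * u) / (m * u))"
proof
  let ?P = "\<Sum>i\<le>n. smult (coeff q i) ([:- k / m, - (l + s) / m:] ^ i * monom 1 (n - i))"
  fix u :: 'a
  assume u: "u \<noteq> 0"
  let ?x = "- (k + l * u + s * u) / (m * u)"
  have lin: "- k / m + u * (- (l + s) / m) = ?x * u"
    using u m by (simp add: field_simps)
  have "poly q ?x = (\<Sum>i\<le>n. coeff q i * ?x ^ i)"
    unfolding poly_altdef
    by (rule sum.mono_neutral_left) (use deg in \<open>auto simp: coeff_eq_0\<close>)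
  then have "u ^ n * poly q ?x = (\<Sum>i\<le>n. u ^ n * (coeff q i * ?x ^ i))"
    by (simp add: sum_distrib_left)
  also have "\<dots> = (\<Sum>i\<le>n. coeff q i * ((?x * u) ^ i * u ^ (n - i)))"
  proof (rule sum.cong[OF refl])
    fix i assume "i \<in> {..n}"
    then have "u ^ n = u ^ i * u ^ (n - i)"
      by (simp flip: power_add)
    then show "u ^ n * (coeff q i * ?x ^ i) = coeff q i * ((?x * u) ^ i * u ^ (n - i))"
      by (simp only: power_mult_distrib ac_simps)
  qed
  also have "\<dots> = poly ?P u"
    unfolding lin[symmetric] by (simp add: poly_sum poly_monom)
  finally show "poly ?P u = u ^ n * poly q ?x" ..
qed

end

theory Submission
  imports Defs "Subresultants.Subresultant"
begin

text \<open>
Up to powers of leading coefficients, the resultant of \<open>G\<close> and \<open>F\<close> is the product of the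
values of \<open>F\<close> at the roots of \<open>G\<close>. So it only depends on \<open>F\<close> modulo \<open>G\<close>
(\<open>root_prod_mod\<close>), and a linear factor \<open>X - \<alpha>\<close> of \<open>F\<close> contributes the value of \<open>G\<close> at
\<open>\<alpha>\<close> up to sign and leading coefficient (\<open>root_prod_linear_mult\<close>). Both facts are obtained from
the Euclidean algorithm, which stays in the given field even when the roots do not lie in it.

Modulo \<open>Phi m\<close> the recurrence turns \<open>Phi (m + 1)\<close> into \<open>- c (m + 1)\<close> times \<open>Phi (m - 1)\<close>, which
gives the resultant of consecutive members of the sequence by induction
(\<open>resultant_Phi_consecutive\<close>). A shift of \<open>Phi (m + 1)\<close> by a multiple of \<open>Phi m\<close> is invisible
modulo \<open>Phi m\<close>; this settles the case \<open>t = 0\<close>.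

Let \<open>t \<noteq> 0\<close>, \<open>F = Phi n + s Phi (n - 1)\<close> and \<open>G = Phi (n - 1) + t Phi (n - 2)\<close>, and let
\<open>x = - (c n + b n t + s t) / (a n t)\<close>. Expressing \<open>Phi n\<close> by the recurrence and \<open>Phi (n - 1)\<close>
by \<open>G\<close> gives

  \<open>F = (a n X + b n + s) G - a n t (X - x) Phi (n - 2)\<close>.

Hence the resultant of \<open>F\<close> and \<open>G\<close> is, up to explicit constants, the value of \<open>G\<close> at \<open>x\<close> times
the resultant of \<open>G\<close> and \<open>Phi (n - 2)\<close>. That resultant equals the one of \<open>Phi (n - 1)\<close> and
\<open>Phi (n - 2)\<close>, and the value of \<open>G\<close> at \<open>x\<close> is \<open>- t / c n\<close> times the value of \<open>F\<close> at \<open>x\<close>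
(\<open>resultant_shifted_shifted\<close>). The signs and exponents of the closed form are compared only
once, through the value at \<open>0\<close> of the polynomial in \<open>t\<close> that extends \<open>t^n F(x)\<close>
(\<open>constant_normalization\<close>).
\<close>

section \<open>Resultants modulo a polynomial\<close>

text \<open>One step of the Euclidean algorithm. The subresultant identity behind it has separate forms
for a constant and a nonconstant remainder; the constant one covers \<open>H = 0\<close>, where both sides
vanish.\<close>

lemma resultant_division_step:
  fixes F B G H :: "'a::idom poly"
  assumes eq: "F + B * G = H" and FG: "degree F \<ge> degree G" and GH: "degree G > degree H"
  shows "resultant F G =
    (-1) ^ (degree F * degree G) * lead_coeff G ^ (degree F - degree H) * resultant G H"
proof (cases "degree H = 0")
  case True
  then obtain h where h: "H = [:h:]"
    by (rule degree_eq_zeroE)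
  have "degree G = Suc (degree G - 1)"
    using GH by simp
  then have pow: "h ^ (degree G - Suc 0) * h = h ^ degree G"
    by (metis One_nat_def power_Suc2)
  have "subresultant 0 F G = smult ((-1) ^ (degree F * degree G)
      * lead_coeff G ^ degree F * lead_coeff H ^ (degree G - 1)) H"
    using BT_lemma_1_13'[OF eq FG disjI1[OF GH], of 0] True GH by simp
  then have "resultant F G = (-1) ^ (degree F * degree G) * lead_coeff G ^ degree F * h ^ degree G"
    unfolding subresultant_resultant by (simp add: h pow mult.assoc)
  then show ?thesis
    by (simp add: h)
next
  case False
  then have "subresultant 0 F G = smult ((-1) ^ (degree F * degree G)
      * lead_coeff G ^ (degree F - degree H)) (subresultant 0 G H)"
    using BT_lemma_1_12[OF eq FG disjI1[OF GH], of 0] by simp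
  then show ?thesis
    unfolding subresultant_resultant by simp
qed

text \<open>Over a splitting field this is the product of the values of \<open>F\<close> over the roots of \<open>G\<close>,
counted with multiplicity. Unlike the resultant, it does not see the degree of \<open>F\<close>.\<close>

definition root_prod :: "'a::field poly \<Rightarrow> 'a poly \<Rightarrow> 'a" where
  "root_prod G F = resultant G F / lead_coeff G ^ degree F"

lemma resultant_root_prod:
  "G \<noteq> 0 \<Longrightarrow> resultant G F = lead_coeff G ^ degree F * root_prod G F"
  by (simp add: root_prod_def)

text \<open>In the division step the sign of \<open>resultant_swap\<close> occurs twice and cancels, and the
normalization by the leading coefficient of \<open>G\<close> absorbs the drop in degree from \<open>F\<close> to the
remainder.\<close>

lemma root_prod_mod:
  fixes F G :: "'a::field poly"
  assumes "G \<noteq> 0"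
  shows "root_prod G F = root_prod G (F mod G)"
proof (cases "degree F < degree G \<or> degree G = 0")
  case True
  then show ?thesis
  proof
    assume "degree F < degree G"
    then show ?thesis by (simp add: mod_poly_less)
  next
    assume "degree G = 0"
    then obtain g where "G = [:g:]" by (rule degree_eq_zeroE)
    then show ?thesis using assms by (simp add: root_prod_def)
  qed
next
  case False
  define H where "H = F mod G"
  have GH: "degree H < degree G"
    using False degree_mod_less[OF assms, of F] by (auto simp: H_def)
  have eq: "F + (- (F div G)) * G = H"
    by (simp add: H_def minus_mult_div_eq_mod[symmetric] mult.commute)
  have FG: "degree G \<le> degree F" using False by simp
  have "resultant G F = (-1) ^ (degree G * degree F) * resultant F G"
    by (rule resultant_swap)
  also have "\<dots> = ((-1) ^ (degree G * degree F) * (-1) ^ (degree G * degree F))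
      * lead_coeff G ^ (degree F - degree H) * resultant G H"
    by (simp add: resultant_division_step[OF eq FG GH] mult.commute[of "degree F"])
  also have "(-1::'a) ^ (degree G * degree F) * (-1) ^ (degree G * degree F) = 1"
    by (simp flip: power_mult_distrib)
  finally show ?thesis
    using assms GH FG by (simp add: root_prod_def H_def[symmetric] power_diff)
qed

lemma root_prod_cong:
  fixes F F' G :: "'a::field poly"
  assumes "G \<noteq> 0" "F mod G = F' mod G"
  shows "root_prod G F = root_prod G F'"
  using assms root_prod_mod[of G F] root_prod_mod[of G F'] by simp

lemma resultant_cong:
  fixes F F' G :: "'a::field poly"
  assumes "G \<noteq> 0" "F mod G = F' mod G" "degree F = degree F'"
  shows "resultant G F = resultant G F'"
  using assms root_prod_cong[OF assms(1,2)] by (simp add: resultant_root_prod)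

section \<open>Splitting off a linear factor\<close>

text \<open>Swapping the arguments turns multiplicativity in the first argument, where \<open>G\<close> can be
reduced modulo \<open>(X - \<alpha>) F\<close>, into multiplicativity in the second argument, where \<open>F\<close> can be
reduced modulo \<open>G\<close>. The proof by the Euclidean algorithm alternates between both.\<close>

lemma root_prod_linear_mult_iff:
  fixes F G :: "'a::field poly" and \<alpha> :: 'a
  assumes F: "F \<noteq> 0" and G: "G \<noteq> 0"
  defines "X \<equiv> [:- \<alpha>, 1:] * F"
  shows "resultant X G = poly G \<alpha> * resultant F G \<longleftrightarrow>
           root_prod G X = (-1) ^ degree G * poly G \<alpha> / lead_coeff G * root_prod G F"
proof -
  have deg: "degree X = Suc (degree F)"
    using F by (simp add: X_def degree_mult_eq del: mult_pCons_left)
  \<comment> \<open>Each side of the second equation is this nonzero factor times the corresponding side of the first.\<close>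
  define k where "k = (-1) ^ degree G * (-1) ^ (degree G * degree F) / (lead_coeff G * lead_coeff G ^ degree F)"
  have "k \<noteq> 0"
    using G by (simp add: k_def)
  moreover have "root_prod G X = k * resultant X G"
    by (simp add: k_def root_prod_def deg resultant_swap[of G X] power_add)
  moreover have "(-1) ^ degree G * poly G \<alpha> / lead_coeff G * root_prod G F
      = k * (poly G \<alpha> * resultant F G)"
    by (simp add: k_def root_prod_def resultant_swap[of G F])
  ultimately show ?thesis
    by simp
qed

text \<open>The remainder of \<open>G\<close> modulo \<open>(X - \<alpha>) F\<close> has smaller degree than \<open>G\<close>, and it agrees with
\<open>G\<close> both at \<open>\<alpha>\<close> and modulo \<open>F\<close>, so neither factor on the right-hand side notices the
reduction apart from the normalization.\<close>

lemma resultant_linear_mult_small: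
  fixes F G :: "'a::field poly"
  assumes F: "F \<noteq> 0" and small: "degree F < degree G"
    and IH: "\<And>R. degree R < degree G \<Longrightarrow>
      resultant ([:- \<alpha>, 1:] * F) R = poly R \<alpha> * resultant F R"
  shows "resultant ([:- \<alpha>, 1:] * F) G = poly G \<alpha> * resultant F G"
proof -
  define X where "X = [:- \<alpha>, 1:] * F"
  define R where "R = G mod X"
  have X0: "X \<noteq> 0" using F by (simp add: X_def del: mult_pCons_left)
  have deg: "degree X = Suc (degree F)"
    using F by (simp add: X_def degree_mult_eq del: mult_pCons_left)
  have lc: "lead_coeff X = lead_coeff F"
    unfolding X_def lead_coeff_mult by simp
  have R: "degree R < degree G"
    using degree_mod_less[OF X0, of G] deg small by (auto simp: R_def)
  have "F dvd X" by (simp add: X_def del: mult_pCons_left)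
  then have modF: "R mod F = G mod F"
    by (simp add: R_def mod_mod_cancel)
  have "G = G div X * X + R" by (simp add: R_def)
  then have "poly G \<alpha> = poly (G div X) \<alpha> * poly X \<alpha> + poly R \<alpha>"
    by (metis poly_add poly_mult)
  then have val: "poly R \<alpha> = poly G \<alpha>"
    by (simp add: X_def)
  have "root_prod X G = root_prod X R"
    using root_prod_mod[OF X0] by (simp add: R_def)
  also have "\<dots> = poly R \<alpha> * root_prod F R"
    using IH[OF R, folded X_def] by (simp add: root_prod_def lc)
  also have "root_prod F R = root_prod F G"
    by (rule root_prod_cong[OF F modF])
  finally show ?thesis
    unfolding X_def[symmetric] using F X0 val by (simp add: resultant_root_prod lc)
qed

text \<open>The resultant is multiplicative and that of \<open>X - \<alpha>\<close> and \<open>G\<close> is the value of \<open>G\<close> at \<open>\<alpha>\<close>.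
The induction reduces \<open>F\<close> modulo \<open>G\<close>, after which \<open>G\<close> can be reduced as well.\<close>

lemma resultant_linear_mult:
  fixes F G :: "'a::field poly"
  assumes "F \<noteq> 0"
  shows "resultant ([:- \<alpha>, 1:] * F) G = poly G \<alpha> * resultant F G"
  using assms
proof (induction "degree G" arbitrary: F G rule: less_induct)
  case less
  have small: "resultant ([:- \<alpha>, 1:] * F') G = poly G \<alpha> * resultant F' G"
    if "F' \<noteq> 0" "degree F' < degree G" for F'
    using resultant_linear_mult_small[OF that less.hyps[OF _ that(1)]] by simp
  show ?case
  proof (cases "degree G = 0")
    case True
    then obtain g where "G = [:g:]" by (rule degree_eq_zeroE)
    then show ?thesis
      using less.prems by (simp add: degree_mult_eq del: mult_pCons_left)
  next
    case False
    then have G: "G \<noteq> 0" by auto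
    define F' where "F' = F mod G"
    have deg: "degree F' < degree G"
      using False degree_mod_less[OF G, of F] by (auto simp: F'_def)
    let ?f = "(-1) ^ degree G * poly G \<alpha> / lead_coeff G"
    have "root_prod G ([:- \<alpha>, 1:] * F') = ?f * root_prod G F'"
    proof (cases "F' = 0")
      case True
      then show ?thesis using False by (simp add: root_prod_def)
    next
      case F': False
      then show ?thesis
        using root_prod_linear_mult_iff[OF F' G] small[OF F' deg] by simp
    qed
    moreover have "root_prod G F' = root_prod G F"
      by (rule root_prod_cong[OF G]) (simp add: F'_def)
    moreover have "root_prod G ([:- \<alpha>, 1:] * F') = root_prod G ([:- \<alpha>, 1:] * F)"
      by (rule root_prod_cong[OF G]) (simp only: F'_def mod_mult_right_eq)
    ultimately show ?thesis
      using root_prod_linear_mult_iff[OF less.prems G] by simp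
  qed
qed

lemma root_prod_linear_mult:
  fixes F G :: "'a::field poly"
  assumes "F \<noteq> 0" "G \<noteq> 0"
  shows "root_prod G ([:- \<alpha>, 1:] * F)
    = (-1) ^ degree G * poly G \<alpha> / lead_coeff G * root_prod G F"
  using root_prod_linear_mult_iff[OF assms] resultant_linear_mult[OF assms(1)] by simp

section \<open>The polynomial extending a homogenized value\<close>

text \<open>The expression \<open>u^n q((k + l u) / u)\<close> is the sum of the terms
\<open>q_i (k + l u)^i u^(n - i)\<close>; at \<open>u = 0\<close> only the one with \<open>i = n\<close> survives.\<close>

lemma homogenization_exists:
  fixes q :: "'a::field poly"
  assumes "degree q \<le> n"
  shows "\<exists>P. (\<forall>u. u \<noteq> 0 \<longrightarrow> poly P u = u ^ n * poly q ((k + l * u) / u))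
    \<and> poly P 0 = coeff q n * k ^ n"
  using assms
proof (induction q arbitrary: n)
  case 0
  show ?case by (rule exI[of _ 0]) simp
next
  case (pCons a q)
  show ?case
  proof (cases n)
    case 0
    then have "q = 0" using pCons.prems by (auto split: if_splits)
    then show ?thesis using 0 by (intro exI[of _ "[:a:]"]) simp
  next
    case (Suc m)
    then have "degree q \<le> m" using pCons.prems by (auto split: if_splits)
    from pCons.IH[OF this] obtain P where
      P: "\<And>u. u \<noteq> 0 \<Longrightarrow> poly P u = u ^ m * poly q ((k + l * u) / u)"
      and P0: "poly P 0 = coeff q m * k ^ m" by blast
    show ?thesis
      using Suc by (intro exI[of _ "monom a n + [:k, l:] * P"])
        (simp add: P P0 poly_monom field_simps)
  qed
qed

section \<open>Sequences with a three-term recurrence\<close>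

locale recurrence =
  fixes a b c :: "nat \<Rightarrow> 'a::field" and Phi :: "nat \<Rightarrow> 'a poly"
  assumes Phi_0: "Phi 0 = 1"
    and Phi_1: "Phi 1 = [:b 1, a 1:]"
    and Phi_rec: "\<And>m. m \<ge> 2 \<Longrightarrow> Phi m = [:b m, a m:] * Phi (m - 1) - smult (c m) (Phi (m - 2))"
    and a_nonzero: "\<And>m. m \<ge> 1 \<Longrightarrow> a m \<noteq> 0"
    and c_nonzero: "\<And>m. m \<ge> 2 \<Longrightarrow> c m \<noteq> 0"
begin

lemma Phi_Suc_Suc:
  "Phi (Suc (Suc m))
     = [:b (Suc (Suc m)), a (Suc (Suc m)):] * Phi (Suc m) - smult (c (Suc (Suc m))) (Phi m)"
  using Phi_rec[of "Suc (Suc m)"] by simp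

lemma degree_Phi_and_coeff:
  "degree (Phi m) = m \<and> coeff (Phi m) m = (\<Prod>k=1..m. a k)"
proof (induction m rule: induct_nat_012)
  case 0
  then show ?case by (simp add: Phi_0)
next
  case 1
  then show ?case using Phi_1 a_nonzero[of 1] by simp
next
  case (ge2 m)
  let ?L = "[:b (Suc (Suc m)), a (Suc (Suc m)):]"
  have co: "coeff (Phi (Suc (Suc m))) (Suc (Suc m)) = (\<Prod>k=1..Suc (Suc m). a k)"
    using ge2 by (simp add: Phi_Suc_Suc coeff_eq_0)
  have "degree (Phi (Suc (Suc m))) \<le> Suc (Suc m)"
    unfolding Phi_Suc_Suc
  proof (rule degree_diff_le)
    show "degree (?L * Phi (Suc m)) \<le> Suc (Suc m)"
      using degree_mult_le[of ?L "Phi (Suc m)"] ge2 degree_pCons_le[of "b (Suc (Suc m))" "[:a (Suc (Suc m)):]"]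
      by (simp del: mult_pCons_left split: if_splits)
    show "degree (smult (c (Suc (Suc m))) (Phi m)) \<le> Suc (Suc m)"
      using ge2 by (intro order.trans[OF degree_smult_le]) simp
  qed
  moreover have "coeff (Phi (Suc (Suc m))) (Suc (Suc m)) \<noteq> 0"
    unfolding co by (auto simp: a_nonzero)
  ultimately show ?case
    using co le_degree by (metis order.antisym)
qed

lemma degree_Phi [simp]: "degree (Phi m) = m"
  using degree_Phi_and_coeff by simp

lemma coeff_Phi: "coeff (Phi m) m = (\<Prod>k=1..m. a k)"
  using degree_Phi_and_coeff by simp

lemma prod_a_nonzero: "(\<Prod>k=1..m. a k) \<noteq> 0"
  by (auto simp: a_nonzero)

lemma Phi_nonzero [simp]: "Phi m \<noteq> 0"
  using coeff_Phi[of m] prod_a_nonzero[of m] by auto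

lemma degree_shifted [simp]: "degree (shifted Phi (Suc m) r) = Suc m"
proof -
  have "degree (smult r (Phi m)) < Suc m"
    using degree_smult_le[of r "Phi m"] by simp
  then show ?thesis
    by (simp add: shifted_def degree_add_eq_left)
qed

lemma coeff_shifted: "coeff (shifted Phi (Suc m) r) (Suc m) = (\<Prod>k=1..Suc m. a k)"
  using coeff_Phi[of "Suc m"] by (simp add: shifted_def coeff_eq_0)

lemma shifted_nonzero [simp]: "shifted Phi (Suc m) r \<noteq> 0"
  using degree_shifted[of m r] by (metis degree_0 nat.distinct(1))

text \<open>The shift adds a multiple of \<open>Phi m\<close> without changing the degree.\<close>

lemma resultant_shifted_Phi:
  "resultant (shifted Phi (Suc m) r) (Phi m) = resultant (Phi (Suc m)) (Phi m)"
proof -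
  have "resultant (Phi m) (shifted Phi (Suc m) r) = resultant (Phi m) (Phi (Suc m))"
  proof (rule resultant_cong)
    show "shifted Phi (Suc m) r mod Phi m = Phi (Suc m) mod Phi m"
      by (simp add: shifted_def poly_mod_add_left mod_smult_left)
  qed simp_all
  then show ?thesis
    by (simp add: resultant_swap[of "shifted Phi (Suc m) r"] resultant_swap[of "Phi (Suc m)"])
qed

text \<open>Modulo \<open>Phi m\<close> the recurrence leaves \<open>- c (m + 1)\<close> times \<open>Phi (m - 1)\<close>. The constant is raised
to the degree \<open>m\<close> of \<open>Phi m\<close>, and the drop of the degree by two brings in the square of the leading
coefficient of \<open>Phi m\<close>.\<close>

lemma resultant_Phi_Suc:
  assumes "m \<ge> 1"
  shows "resultant (Phi (Suc m)) (Phi m)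
    = (\<Prod>k=1..m. a k) ^ 2 * (- c (Suc m)) ^ m * resultant (Phi m) (Phi (m - 1))"
proof -
  obtain j where m: "m = Suc j" using assms by (cases m) auto
  have "resultant (Phi (Suc m)) (Phi m) = resultant (Phi m) (Phi (Suc m))"
    by (simp add: resultant_swap[of "Phi (Suc m)"] minus_1_power_even)
  also have "\<dots> = lead_coeff (Phi m) ^ Suc m * root_prod (Phi m) (Phi (Suc m))"
    by (simp add: resultant_root_prod)
  also have "root_prod (Phi m) (Phi (Suc m)) = root_prod (Phi m) (smult (- c (Suc m)) (Phi j))"
    by (rule root_prod_cong) (simp_all add: m Phi_Suc_Suc poly_mod_diff_left del: mult_pCons_left)
  also have "\<dots> = (- c (Suc m)) ^ m * resultant (Phi m) (Phi j) / lead_coeff (Phi m) ^ j"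
    using resultant_smult_right[of "- c (Suc m)" "Phi m" "Phi j"] c_nonzero[of "Suc m"] assms
    by (simp add: root_prod_def)
  also have "lead_coeff (Phi m) ^ Suc m * \<dots>
      = lead_coeff (Phi m) ^ 2 * (- c (Suc m)) ^ m * resultant (Phi m) (Phi j)"
    by (simp add: m power2_eq_square)
  finally show ?thesis
    by (simp add: m coeff_Phi)
qed

lemma resultant_Phi_consecutive:
  "resultant (Phi (Suc m)) (Phi m)
    = (-1) ^ (Suc m * m div 2) * (\<Prod>k = 1..Suc m. a k ^ (2 * Suc m - 2 * k) * c k ^ (k - 1))"
proof (induction m)
  case 0
  then show ?case by (simp add: Phi_0)
next
  case (Suc m)
  define A where "A = (\<Prod>k=1..Suc m. a k)"
  have A: "(\<Prod>k=1..Suc m. a k ^ (2 * Suc (Suc m) - 2 * k) * c k ^ (k - 1))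
      = A ^ 2 * (\<Prod>k=1..Suc m. a k ^ (2 * Suc m - 2 * k) * c k ^ (k - 1))"
    unfolding A_def prod_power_distrib prod.distrib[symmetric]
  proof (rule prod.cong[OF refl])
    fix k assume "k \<in> {1..Suc m}"
    then have "2 * Suc (Suc m) - 2 * k = 2 + (2 * Suc m - 2 * k)" by auto
    then show "a k ^ (2 * Suc (Suc m) - 2 * k) * c k ^ (k - 1)
        = a k ^ 2 * (a k ^ (2 * Suc m - 2 * k) * c k ^ (k - 1))"
      by (simp only: power_add mult.assoc)
  qed
  have "Suc (Suc m) * Suc m = Suc m * m + Suc m * 2"
    by simp
  then have "Suc (Suc m) * Suc m div 2 = Suc m * m div 2 + Suc m"
    by (metis div_mult_self1 add.commute zero_neq_numeral)
  then have sign: "(-1::'a) ^ (Suc (Suc m) * Suc m div 2) = (-1) ^ (Suc m * m div 2) * (-1) ^ Suc m"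
    by (simp only: power_add)
  have "resultant (Phi (Suc (Suc m))) (Phi (Suc m))
      = A ^ 2 * (- c (Suc (Suc m))) ^ Suc m * resultant (Phi (Suc m)) (Phi m)"
    using resultant_Phi_Suc[of "Suc m"] by (simp add: A_def)
  also have "\<dots> = (-1) ^ (Suc (Suc m) * Suc m div 2) * (c (Suc (Suc m)) ^ Suc m *
      (A ^ 2 * (\<Prod>k=1..Suc m. a k ^ (2 * Suc m - 2 * k) * c k ^ (k - 1))))"
    unfolding Suc sign power_minus[of "c _"] by (simp only: mult_ac)
  also have "\<dots> = (-1) ^ (Suc (Suc m) * Suc m div 2) *
      (\<Prod>k = 1..Suc (Suc m). a k ^ (2 * Suc (Suc m) - 2 * k) * c k ^ (k - 1))"
    unfolding A[symmetric] by (subst (2) prod.nat_ivl_Suc') (simp_all only: diff_self_eq_0 diff_Suc_1 power_0 mult_1_left)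
  finally show ?case .
qed

text \<open>The elimination argument for \<open>t \<noteq> 0\<close>: the first shifted polynomial is, modulo the second one,
a multiple of \<open>(X - x) Phi m\<close>, whose linear factor can be split off.\<close>

lemma resultant_shifted_shifted:
  fixes s t :: 'a and m :: nat
  assumes t: "t \<noteq> 0"
  defines "n \<equiv> Suc (Suc m)"
  defines "x \<equiv> - (c n + b n * t + s * t) / (a n * t)"
  shows "resultant (shifted Phi n s) (shifted Phi (Suc m) t)
    = - (\<Prod>k=1..Suc m. a k) * a n ^ Suc m / c n * resultant (Phi (Suc m)) (Phi m)
      * (t ^ n * poly (shifted Phi n s) x)"
proof -
  define F where "F = shifted Phi n s"
  define G where "G = shifted Phi (Suc m) t"
  define A where "A = lead_coeff G"
  have [simp]: "degree F = n" "degree G = Suc m" "F \<noteq> 0" "G \<noteq> 0"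
    by (simp_all add: F_def G_def n_def)
  have A0: "A \<noteq> 0" unfolding A_def leading_coeff_0_iff by simp
  have A: "A = (\<Prod>k=1..Suc m. a k)"
    by (simp only: A_def \<open>degree G = Suc m\<close>) (simp only: G_def coeff_shifted)
  have an: "a n \<noteq> 0" and cn: "c n \<noteq> 0"
    using a_nonzero c_nonzero by (simp_all add: n_def)
  have F_eq: "F = [:b n + s, a n:] * Phi (Suc m) - smult (c n) (Phi m)"
  proof -
    have "[:b n + s, a n:] * Phi (Suc m) = [:b n, a n:] * Phi (Suc m) + smult s (Phi (Suc m))"
      by (simp add: smult_add_left)
    moreover have "F = Phi n + smult s (Phi (Suc m))"
      by (simp add: F_def shifted_def n_def)
    moreover have "Phi n = [:b n, a n:] * Phi (Suc m) - smult (c n) (Phi m)"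
      by (simp only: n_def Phi_Suc_Suc)
    ultimately show ?thesis by simp
  qed
  have root: "a n * t * x = - (c n + b n * t + s * t)"
    using an t by (simp add: x_def)
  \<comment> \<open>Subtracting \<open>(a n X + b n + s) G\<close> from \<open>F\<close> leaves a multiple of \<open>Phi m\<close> by a linear polynomial
    with slope \<open>- a n t\<close>, and \<open>x\<close> is the root of that polynomial.\<close>
  have division: "F = [:b n + s, a n:] * G - [:- x, 1:] * smult (a n * t) (Phi m)"
  proof -
    have "smult (a n * t) [:- x, 1:] = [:c n:] + smult t [:b n + s, a n:]"
    proof -
      have "- (a n * t * x) = c n + t * (b n + s)"
        unfolding root by (simp add: algebra_simps)
      then show ?thesis by simp
    qed
    then have "smult (a n * t) [:- x, 1:] * Phi m = ([:c n:] + smult t [:b n + s, a n:]) * Phi m"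
      by (rule arg_cong)
    then have "[:- x, 1:] * smult (a n * t) (Phi m) = smult (c n) (Phi m) + smult t ([:b n + s, a n:] * Phi m)"
      unfolding distrib_right mult_smult_left mult_smult_right by simp
    then show ?thesis
      unfolding F_eq G_def shifted_def by (simp add: distrib_left del: mult_pCons_left)
  qed
  have at_x: "t * poly F x = - c n * poly G x"
  proof -
    have "t * (a n * x + b n + s) = - c n"
      using root by (simp add: algebra_simps)
    moreover have "t * poly F x
        = t * (a n * x + b n + s) * poly (Phi (Suc m)) x - c n * t * poly (Phi m) x"
      unfolding F_eq by (simp add: algebra_simps)
    ultimately show ?thesis
      by (simp add: G_def shifted_def algebra_simps)
  qed
  have base: "resultant G (Phi m) = resultant (Phi (Suc m)) (Phi m)"
  proof -
    have "resultant (Phi m) G = resultant (Phi m) (Phi (Suc m))"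
    proof (rule resultant_cong)
      show "G mod Phi m = Phi (Suc m) mod Phi m"
        by (simp add: G_def shifted_def poly_mod_add_left mod_smult_left)
    qed simp_all
    then show ?thesis
      by (simp add: resultant_swap[of G] resultant_swap[of "Phi (Suc m)"])
  qed
  have "resultant F G = resultant G F"
    by (simp add: resultant_swap[of F] minus_1_power_even n_def)
  also have "\<dots> = A ^ n * root_prod G F"
    by (simp add: resultant_root_prod A_def)
  also have "root_prod G F = root_prod G ([:- x, 1:] * smult (- (a n * t)) (Phi m))"
    by (rule root_prod_cong) (simp_all add: division poly_mod_diff_left del: mult_pCons_left)
  also have "\<dots> = (-1) ^ Suc m * poly G x / A * root_prod G (smult (- (a n * t)) (Phi m))"
    using an t by (subst root_prod_linear_mult) (simp_all add: A_def)
  also have "root_prod G (smult (- (a n * t)) (Phi m))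
      = (-1) ^ Suc m * (a n * t) ^ Suc m * resultant (Phi (Suc m)) (Phi m) / A ^ m"
    using an t resultant_smult_right[of "- (a n * t)" G "Phi m"]
    by (simp add: root_prod_def A_def base power_minus[of "a n * t"])
  finally have "resultant F G = ((-1) ^ Suc m * (-1) ^ Suc m)
      * (A * (a n * t) ^ Suc m * poly G x * resultant (Phi (Suc m)) (Phi m))"
    using A0 by (simp add: n_def field_simps)
  also have "(-1::'a) ^ Suc m * (-1) ^ Suc m = 1"
    by (simp flip: power_mult_distrib)
  also have "poly G x = - (t * poly F x) / c n"
    using at_x cn by (simp add: field_simps)
  finally show ?thesis
    unfolding F_def[symmetric] G_def[symmetric] A[symmetric]
    by (simp add: power_mult_distrib n_def mult_ac)
qed

end

text \<open>The prefactor of the general formula and the value of the formula for \<open>t = 0\<close> differ by the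
value at \<open>0\<close> of the extending polynomial, which is the leading coefficient of \<open>Phi n\<close> times the
\<open>n\<close>-th power of \<open>- c n / a n\<close>.\<close>

lemma constant_normalization:
  fixes a c :: "nat \<Rightarrow> 'a::field"
  assumes a: "\<And>k. k \<ge> 1 \<Longrightarrow> a k \<noteq> 0" and c: "c n \<noteq> 0" and n: "n \<ge> 1"
  shows "(-1) ^ (n * (n + 1) div 2) * a n ^ n * c n powi (- int n)
      * (\<Prod>k = 1..n. a k powi (2 * int n - 2 * int k - 1) * c k ^ (k - 1))
      * ((\<Prod>k = 1..n. a k) * (- c n / a n) ^ n)
    = (-1) ^ (n * (n - 1) div 2) * (\<Prod>k = 1..n. a k ^ (2 * n - 2 * k) * c k ^ (k - 1))"
proof -
  have an: "a n \<noteq> 0" using a n by simp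
  have exponents: "(\<Prod>k = 1..n. a k powi (2 * int n - 2 * int k - 1) * c k ^ (k - 1)) * (\<Prod>k = 1..n. a k)
      = (\<Prod>k = 1..n. a k ^ (2 * n - 2 * k) * c k ^ (k - 1))" (is "?P * ?A = ?Q")
    unfolding prod.distrib[symmetric]
  proof (rule prod.cong[OF refl])
    fix k assume k: "k \<in> {1..n}"
    then have "a k powi (2 * int n - 2 * int k - 1) * a k = a k powi int (2 * n - 2 * k)"
      using a[of k] power_int_add_1[of "a k" "2 * int n - 2 * int k - 1"] by (simp add: of_nat_diff)
    then show "a k powi (2 * int n - 2 * int k - 1) * c k ^ (k - 1) * a k
        = a k ^ (2 * n - 2 * k) * c k ^ (k - 1)"
      by (simp add: mult_ac)
  qed
  have sign: "(-1::'a) ^ (n * (n + 1) div 2) * (-1) ^ n = (-1) ^ (n * (n - 1) div 2)"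
  proof -
    obtain j where j: "n = Suc j" using n by (cases n) auto
    have "n * (n + 1) = n * (n - 1) + n * 2" by (simp add: j)
    then have "n * (n + 1) div 2 = n * (n - 1) div 2 + n"
      by (metis div_mult_self1 add.commute zero_neq_numeral)
    then show ?thesis
      by (simp add: power_add flip: power_mult_distrib)
  qed
  have last: "a n ^ n * c n powi (- int n) * (- c n / a n) ^ n = (-1) ^ n"
  proof -
    have "a n ^ n * (- c n / a n) ^ n = (- c n) ^ n"
      using an by (simp flip: power_mult_distrib)
    then show ?thesis
      using c by (simp add: power_int_minus power_minus[of "c n"] field_simps)
  qed
  have "(-1) ^ (n * (n + 1) div 2) * a n ^ n * c n powi (- int n) * ?P * (?A * (- c n / a n) ^ n)
      = (-1) ^ (n * (n + 1) div 2) * (a n ^ n * c n powi (- int n) * (- c n / a n) ^ n) * (?P * ?A)"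
    by (simp only: mult_ac)
  also have "\<dots> = (-1) ^ (n * (n - 1) div 2) * ?Q"
    unfolding last sign exponents ..
  finally show ?thesis .
qed

theorem theorem3p1:
  fixes a b c :: "nat \<Rightarrow> 'a::real_normed_field"
    and Phi :: "nat \<Rightarrow> 'a poly"
    and s t :: 'a
    and n :: nat
  assumes Phi_0: "Phi 0 = 1"
    and Phi_1: "Phi 1 = [:b 1, a 1:]"
    and Phi_rec: "\<And>m. m \<ge> 2 \<Longrightarrow> Phi m = [:b m, a m:] * Phi (m - 1) - smult (c m) (Phi (m - 2))"
    and a_nonzero: "\<And>m. m \<ge> 1 \<Longrightarrow> a m \<noteq> 0"
    and c_nonzero: "\<And>m. m \<ge> 2 \<Longrightarrow> c m \<noteq> 0"
    and n: "n \<ge> 2"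
  shows "resultant (shifted Phi n s) (shifted Phi (n - 1) t) =
           (-1) ^ (n * (n + 1) div 2) * a n ^ n * c n powi (- int n)
           * (\<Prod>k = 1..n. a k powi (2 * int n - 2 * int k - 1) * c k ^ (k - 1))
           * poly_extension
               (\<lambda>u. u ^ n * poly (shifted Phi n s) (- (c n + b n * u + s * u) / (a n * u))) t
       \<and> resultant (shifted Phi n s) (Phi (n - 1)) = resultant (Phi n) (Phi (n - 1))
       \<and> resultant (Phi n) (Phi (n - 1)) =
           (-1) ^ (n * (n - 1) div 2) * (\<Prod>k = 1..n. a k ^ (2 * n - 2 * k) * c k ^ (k - 1))"
proof -
  interpret recurrence a b c Phi
    by unfold_locales (fact Phi_0 Phi_1 Phi_rec a_nonzero c_nonzero)+
  obtain m where m: "n = Suc (Suc m)"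
    using n by (metis Suc_le_D numeral_2_eq_2 Suc_le_mono)
  have an: "a n \<noteq> 0" and cn: "c n \<noteq> 0"
    using a_nonzero c_nonzero n by simp_all
  define F where "F = shifted Phi n s"
  define f where "f = (\<lambda>u. u ^ n * poly F (- (c n + b n * u + s * u) / (a n * u)))"
  define A where "A = (\<Prod>k = 1..n. a k)"
  define R where "R = resultant (Phi n) (Phi (n - 1))"
  define K where "K = (-1) ^ (n * (n + 1) div 2) * a n ^ n * c n powi (- int n)
    * (\<Prod>k = 1..n. a k powi (2 * int n - 2 * int k - 1) * c k ^ (k - 1))"
  \<comment> \<open>\<open>D\<close> is the value of the extending polynomial at \<open>0\<close>. It is nonzero, so the constant in front
    of the formula for \<open>t \<noteq> 0\<close> is determined by its product with \<open>D\<close>.\<close>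
  define D where "D = A * (- c n / a n) ^ n"
  have D0: "D \<noteq> 0"
    using prod_a_nonzero[of n] an cn by (simp add: D_def A_def)
  have R: "R = (-1) ^ (n * (n - 1) div 2) * (\<Prod>k = 1..n. a k ^ (2 * n - 2 * k) * c k ^ (k - 1))"
    using resultant_Phi_consecutive[of "Suc m"] by (simp only: R_def m diff_Suc_1)
  have KD: "K * D = R"
    unfolding K_def D_def A_def R
    by (rule constant_normalization) (use a_nonzero cn n in auto)
  have shift: "resultant F (Phi (n - 1)) = R"
    using resultant_shifted_Phi[of "Suc m" s] by (simp add: F_def R_def m)
  have degF: "degree F \<le> n" and lcF: "coeff F n = A"
    using coeff_shifted[of "Suc m" s] by (simp_all only: F_def A_def m degree_shifted order.refl)
  have arg: "- (c n + b n * u + s * u) / (a n * u) = (- c n / a n + (- (b n + s) / a n) * u) / u"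
    if "u \<noteq> 0" for u
    using an that by (simp add: field_simps)
  obtain P where P: "\<And>u. u \<noteq> 0 \<Longrightarrow> poly P u = f u" and P0: "poly P 0 = D"
    using homogenization_exists[OF degF, of "- c n / a n" "- (b n + s) / a n"]
    unfolding f_def lcF D_def by (metis arg)
  have ext: "poly_extension f t = poly P t"
    using P by (rule poly_extension_eq)
  have "resultant F (shifted Phi (n - 1) t) = K * poly P t"
  proof (cases "t = 0")
    case True
    then show ?thesis
      using shift KD P0 by (simp add: shifted_def)
  next
    case False
    define A' where "A' = (\<Prod>k = 1..Suc m. a k)"
    have A: "A = A' * a n"
      by (simp add: A_def A'_def m)
    have pw: "a n ^ n * (- c n / a n) ^ n = - c n * (- c n) ^ Suc m"
      using an by (simp add: m flip: power_mult_distrib)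
    have "- A' * a n ^ Suc m / c n * resultant (Phi (Suc m)) (Phi m) * D
        = - A' * A' / c n * resultant (Phi (Suc m)) (Phi m) * (a n ^ n * (- c n / a n) ^ n)"
      by (simp add: D_def A m mult_ac)
    also have "\<dots> = A' ^ 2 * (- c n) ^ Suc m * resultant (Phi (Suc m)) (Phi m)"
      unfolding pw using cn by (simp add: power2_eq_square)
    also have "\<dots> = R"
      using resultant_Phi_Suc[of "Suc m"] by (simp only: R_def m A'_def diff_Suc_1)
    finally have "- A' * a n ^ Suc m / c n * resultant (Phi (Suc m)) (Phi m) * D = R" .
    then have "- A' * a n ^ Suc m / c n * resultant (Phi (Suc m)) (Phi m) = K"
      using KD D0 by (metis mult_right_cancel)
    moreover have "resultant F (shifted Phi (n - 1) t)
      = - A' * a n ^ Suc m / c n * resultant (Phi (Suc m)) (Phi m) * f t"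
      using resultant_shifted_shifted[OF False, of m s]
      by (simp add: F_def f_def A'_def m)
    ultimately show ?thesis
      using P[OF False] by simp
  qed
  then show ?thesis
    using shift R unfolding ext[symmetric] f_def K_def F_def R_def by blast
qed

end
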